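(* The moon $\{\infty\,|\,\overline{\infty}\}$ is absorbing modulo $\mathbb{Im}^\infty$: for all $Y\in\mathbb{Im}^\infty$, $\{\infty\,|\,\overline{\infty}\}+Y=_{\mathbb{Im}^\infty}\{\infty\,|\,\overline{\infty}\}$.
   Context: Affine normal play forms are built from terminating games $\infty$ (Left wins) and $\overline{\infty}$ (Right wins), with $\infty+X=\infty$ for $X\neq\overline{\infty}$ and $\overline{\infty}+X=\overline{\infty}$ for $X\neq\infty$. $\mathbb{Im}^\infty$ is the class of affine impartial forms: symmetric forms (Right options are conjugates of Left options) all of whose quiet (non-check, non-infinity) followers are symmetric. $G=_{\mathbb{Im}^\infty}H$ means $o(G+X)=o(H+X)$ for every $X\in\mathbb{Im}^\infty$. The moon is the form $\{\infty\,|\,\overline{\infty}\}$, in which the first player to move wins. *)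

theory Defs
  imports "HOL-Library.FSet"
begin

text \<open>
  Forms are short: option sets are finite and the length of play is bounded.  Empty option sets are allowed, and
  a player who has no option loses; thus both \<open>Form {||} {||}\<close> and \<open>Form {|RightInf|} {|LeftInf|}\<close>
  are forms of zero.  \<open>LeftInf\<close> is the infinity at which Left has won, \<open>RightInf\<close> its conjugate.
\<close>

datatype form = LeftInf | RightInf | Form "form fset" "form fset"

lemma size_option:
  "x |\<in>| L \<Longrightarrow> size x < size (Form L R)"
  "x |\<in>| R \<Longrightarrow> size x < size (Form L R)"
proof -
  have "size x < (\<Sum>y\<in>fset A. Suc (size y))" if "x |\<in>| A" for A
    using member_le_sum[of x "fset A" "\<lambda>y. Suc (size y)"] that by simp
  then show "x |\<in>| L \<Longrightarrow> size x < size (Form L R)" "x |\<in>| R \<Longrightarrow> size x < size (Form L R)"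
    by force+
qed

declare fimage_cong [fundef_cong]

primrec conjugate :: "form \<Rightarrow> form" where
  "conjugate LeftInf = RightInf"
| "conjugate RightInf = LeftInf"
| "conjugate (Form L R) = Form (conjugate |`| R) (conjugate |`| L)"

text \<open>
  Disjunctive sum.  The sum of the two different infinities is not defined in the theory; here it
  is \<open>undefined\<close>.  It never arises while unfolding any other sum, because a sum with an infinite
  summand is terminal.
\<close>

instantiation form :: plus
begin

function plus_form :: "form \<Rightarrow> form \<Rightarrow> form" where
  "LeftInf + LeftInf = LeftInf"
| "LeftInf + Form L R = LeftInf"
| "Form L R + LeftInf = LeftInf"
| "RightInf + RightInf = RightInf"
| "RightInf + Form L R = RightInf"
| "Form L R + RightInf = RightInf"
| "LeftInf + RightInf = undefined"
| "RightInf + LeftInf = undefined"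
| "Form L R + Form L' R' =
     Form ((\<lambda>x. x + Form L' R') |`| L |\<union>| (\<lambda>y. Form L R + y) |`| L')
          ((\<lambda>x. x + Form L' R') |`| R |\<union>| (\<lambda>y. Form L R + y) |`| R')"
  by pat_completeness auto
termination
  by (relation "measure (\<lambda>(G, H). size G + size H)")
     (auto simp del: form.size simp: size_option)

instance ..

end

function left_wins_first :: "form \<Rightarrow> bool" and left_wins_second :: "form \<Rightarrow> bool" where
  "left_wins_first LeftInf \<longleftrightarrow> True"
| "left_wins_first RightInf \<longleftrightarrow> False"
| "left_wins_first (Form L R) \<longleftrightarrow> (\<exists>x |\<in>| L. left_wins_second x)"
| "left_wins_second LeftInf \<longleftrightarrow> True"
| "left_wins_second RightInf \<longleftrightarrow> False"
| "left_wins_second (Form L R) \<longleftrightarrow> (\<forall>x |\<in>| R. left_wins_first x)"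
  by pat_completeness auto
termination
  by (relation "measure (case_sum size size)") (auto simp del: form.size simp: size_option)

datatype outcome_class = Left_wins | Next_wins | Previous_wins | Right_wins

definition outcome :: "form \<Rightarrow> outcome_class" where
  "outcome G =
     (if left_wins_first G
      then (if left_wins_second G then Left_wins else Next_wins)
      else (if left_wins_second G then Previous_wins else Right_wins))"

definition is_check :: "form \<Rightarrow> bool" where
  "is_check G \<longleftrightarrow> (\<exists>L R. G = Form L R \<and> (LeftInf |\<in>| L \<or> RightInf |\<in>| R))"

definition quiet :: "form \<Rightarrow> bool" where
  "quiet G \<longleftrightarrow> G \<noteq> LeftInf \<and> G \<noteq> RightInf \<and> \<not> is_check G"

text \<open>The infinities have no option sets and are not symmetric.\<close>

definition symmetric :: "form \<Rightarrow> bool" where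
  "symmetric G \<longleftrightarrow> (\<exists>L R. G = Form L R \<and> R = conjugate |`| L)"

text \<open>Moves leading to a follower need not alternate between the players.\<close>

inductive follower :: "form \<Rightarrow> form \<Rightarrow> bool" for G where
  follower_refl: "follower G G"
| follower_left: "follower G (Form L R) \<Longrightarrow> x |\<in>| L \<Longrightarrow> follower G x"
| follower_right: "follower G (Form L R) \<Longrightarrow> x |\<in>| R \<Longrightarrow> follower G x"

definition affine_impartial :: "form set" where
  "affine_impartial = {G. symmetric G \<and> (\<forall>H. follower G H \<longrightarrow> quiet H \<longrightarrow> symmetric H)}"

definition eq_modulo :: "form set \<Rightarrow> form \<Rightarrow> form \<Rightarrow> bool" where
  "eq_modulo \<A> G H \<longleftrightarrow> (\<forall>X\<in>\<A>. outcome (G + X) = outcome (H + X))"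

definition moon :: form where
  "moon = Form {|LeftInf|} {|RightInf|}"

end

theory Submission
  imports Defs
begin

text \<open>Whoever moves first can play in the moon to the infinity that wins for them, and this
  infinity absorbs every other summand that is a \<open>Form\<close>. So a sum of the moon with any
  such summands keeps \<open>LeftInf\<close> as a Left option and \<open>RightInf\<close> as a Right
  option, and the mover wins at once: both sides of the equality have outcome
  \<open>Next_wins\<close>.\<close>

lemma outcome_immediate_infinities:
  assumes "LeftInf |\<in>| L" and "RightInf |\<in>| R"
  shows "outcome (Form L R) = Next_wins"
proof -
  have "left_wins_first (Form L R)"
    using assms(1) by (auto intro!: bexI[of _ LeftInf])
  moreover have "\<not> left_wins_second (Form L R)"
    using assms(2) by (auto intro!: bexI[of _ RightInf])
  ultimately show ?thesis
    by (simp add: outcome_def)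
qed

lemma outcome_moon_plus: "outcome (moon + Form L R) = Next_wins"
  by (simp add: moon_def outcome_immediate_infinities)

lemma outcome_moon_plus_plus: "outcome (moon + Form L R + Form L' R') = Next_wins"
  by (simp add: moon_def outcome_immediate_infinities)

theorem theorem3p22:
  fixes Y :: form
  assumes "Y \<in> affine_impartial"
  shows "eq_modulo affine_impartial (moon + Y) moon"
  unfolding eq_modulo_def
proof
  fix X
  assume "X \<in> affine_impartial"
  \<comment> \<open>Symmetry rules out the infinities, which would themselves absorb the moon:
    \<open>moon + LeftInf\<close> is \<open>LeftInf\<close>.\<close>
  then obtain L R where X: "X = Form L R"
    by (auto simp: affine_impartial_def symmetric_def)
  obtain L' R' where Y: "Y = Form L' R'"
    using assms by (auto simp: affine_impartial_def symmetric_def)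
  show "outcome (moon + Y + X) = outcome (moon + X)"
    unfolding X Y by (simp only: outcome_moon_plus outcome_moon_plus_plus)
qed

end
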